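(* Assume there is some $n_0\in\mathbb{N}$ such that the following holds: there are a sequence $(X_n)_{n\geq n_0}$ of random variables, a sequence $\epsilon=(\varepsilon_n)_{n\geq n_0}$ of nonincreasing, summable, positive numbers, and a random variable $X$ such that $$\mathrm{d}_{\mathrm{KF}}(X_n,X)\leq\varepsilon_n\qquad\text{for all }n\geq n_0.$$ Then $X_n$ converges completely to $X$, that is, $\sum_{n=n_0}^\infty\mathbb{P}(|X_n-X|>\varepsilon)<\infty$ for every $\varepsilon>0$; and we have the asymptotic error tolerance $$\limsup_{n\to\infty}|X_n-X|\cdot\varepsilon_n^{-1}\leq1\qquad\mathbb{P}\text{-a.s.}$$ with mean error incidence $$\mathbb{E}[\mathcal{S}_{\theta,n_0}(\mathcal{O}_{\epsilon,n_0})]\leq\mathbb{E}[\mathcal{S}_{\theta,n_0}(\mathbf{m}_{\epsilon,n_0})]\leq\sum_{n=n_0}^\infty\frac{1}{n\log^{1+\theta}(n+1)}\qquad\text{for any }\theta>0,$$ where $\mathcal{S}_{\theta,n_0}(0)=0$ and $$\mathcal{S}_{\theta,n_0}(N)=\sum_{n=n_0}^{n_0+N-1}\Big(n\log^{1+\theta}(n+1)\sum_{m=n}^\infty\varepsilon_m\Big)^{-1}.$$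
   Context: $\mathbb{N}=\{1,2,\dots\}$; $\log$ is the natural logarithm; $\mathbf{1}$ denotes an indicator function. The Ky Fan metric of two random variables $X,Y$ on a given probability space $(\Omega,\mathcal{A},\mathbb{P})$ is $\mathrm{d}_{\mathrm{KF}}(X,Y):=\inf\{\varepsilon>0:\mathbb{P}(|X-Y|>\varepsilon)\leq\varepsilon\}$. $\mathcal{O}_{\epsilon,n_0}:=\sum_{n=n_0}^\infty\mathbf{1}\{|X_n-X|>\varepsilon_n\}$. $\mathbf{m}_{\epsilon,n_0}:=\max\{n\geq n_0:|X_n-X|>\varepsilon_n\}$.
   Formalization: The final bound by the series is stated with m+1−n_0 (0 if no exceedance), the number of indices from n_0 to the last exceedance, in place of m as argument of S; with m itself it fails for n_0≥2. For n_0=1 the two coincide, and E[S(O)]≤E[S(m)] is kept. *)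

theory Defs
  imports "HOL-Probability.Probability"
begin

definition ky_fan :: "'a measure \<Rightarrow> ('a \<Rightarrow> real) \<Rightarrow> ('a \<Rightarrow> real) \<Rightarrow> real" where
  "ky_fan M X Y =
     Inf {e. 0 < e \<and> measure M {\<omega> \<in> space M. \<bar>X \<omega> - Y \<omega>\<bar> > e} \<le> e}"

text \<open>
  Both counting variables below can be infinite (on a null set), so they take values in
  \<^typ>\<open>enat\<close>.
\<close>

definition overlap :: "(nat \<Rightarrow> 'a \<Rightarrow> real) \<Rightarrow> ('a \<Rightarrow> real) \<Rightarrow> (nat \<Rightarrow> real) \<Rightarrow> nat \<Rightarrow> 'a \<Rightarrow> enat" where
  "overlap X Y \<epsilon> n0 \<omega> =
     (\<Sum>k. indicator {\<omega>. \<bar>X (n0 + k) \<omega> - Y \<omega>\<bar> > \<epsilon> (n0 + k)} \<omega>)"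

text \<open>
  The supremum in \<^typ>\<open>enat\<close> is the maximum for a finite nonempty set of indices,
  \<open>0\<close> for the empty set and \<open>\<infinity>\<close> for an infinite one.
\<close>

definition last_exceed :: "(nat \<Rightarrow> 'a \<Rightarrow> real) \<Rightarrow> ('a \<Rightarrow> real) \<Rightarrow> (nat \<Rightarrow> real) \<Rightarrow> nat \<Rightarrow> 'a \<Rightarrow> enat" where
  "last_exceed X Y \<epsilon> n0 \<omega> =
     (SUP n \<in> {n. n0 \<le> n \<and> \<bar>X n \<omega> - Y \<omega>\<bar> > \<epsilon> n}. enat n)"

definition S_coeff :: "real \<Rightarrow> (nat \<Rightarrow> real) \<Rightarrow> nat \<Rightarrow> real" where
  "S_coeff \<theta> \<epsilon> n =
     inverse (real n * ln (real (n + 1)) powr (1 + \<theta>) * (\<Sum>k. \<epsilon> (n + k)))"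

text \<open>At \<open>\<infinity>\<close> the sum is continued to the full series, which may diverge.\<close>

definition S_fun :: "real \<Rightarrow> nat \<Rightarrow> (nat \<Rightarrow> real) \<Rightarrow> enat \<Rightarrow> ennreal" where
  "S_fun \<theta> n0 \<epsilon> N = (case N of
       enat N' \<Rightarrow> (\<Sum>n = n0..<n0 + N'. ennreal (S_coeff \<theta> \<epsilon> n))
     | \<infinity> \<Rightarrow> (\<Sum>k. ennreal (S_coeff \<theta> \<epsilon> (n0 + k))))"

text \<open>
  \<^const>\<open>S_fun\<close> takes a number of terms, counted from the index \<open>n0\<close>, whereas
  \<^const>\<open>last_exceed\<close> is an index. The number of terms with indices from \<open>n0\<close> up to the last
  exceedance is \<open>m + 1 - n0\<close>, with truncated subtraction on \<^typ>\<open>enat\<close>; for \<open>n0 \<ge> 1\<close> this is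
  \<open>0\<close> if there is no exceedance, and for \<open>n0 = 1\<close> it equals \<open>m\<close>.
  With the index \<open>m\<close> itself as argument, \<open>S\<close> would sum over indices beyond \<open>m\<close> when \<open>n0 \<ge> 2\<close>,
  and its mean would not admit a bound independent of \<open>\<epsilon>\<close>.
\<close>

definition last_exceed_pos :: "(nat \<Rightarrow> 'a \<Rightarrow> real) \<Rightarrow> ('a \<Rightarrow> real) \<Rightarrow> (nat \<Rightarrow> real) \<Rightarrow> nat \<Rightarrow> 'a \<Rightarrow> enat" where
  "last_exceed_pos X Y \<epsilon> n0 \<omega> = last_exceed X Y \<epsilon> n0 \<omega> + 1 - enat n0"

lemma last_exceed_pos_1: "last_exceed_pos X Y \<epsilon> 1 = last_exceed X Y \<epsilon> 1"
proof
  fix \<omega>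
  show "last_exceed_pos X Y \<epsilon> 1 \<omega> = last_exceed X Y \<epsilon> 1 \<omega>"
    unfolding last_exceed_pos_def
    by (cases "last_exceed X Y \<epsilon> 1 \<omega>") (auto simp: one_enat_def)
qed

end

theory Submission
  imports Defs
begin

text \<open>
  Continuity from below at the infimum in the Ky Fan metric gives \<open>P(|X n - Y| > \<epsilon> n) \<le> \<epsilon> n\<close>. Summability of
  \<open>\<epsilon>\<close> then yields complete convergence, and Borel--Cantelli the error tolerance.
  For the mean error incidence, the \<open>k\<close>-th term of \<open>S\<close> at the last exceedance is present exactly
  when some exceedance has index at least \<open>n0 + k\<close>. By the union bound this has
  probability at most the tail sum of \<open>\<epsilon>\<close> from \<open>n0 + k\<close>, which cancels the tail sum in the
  coefficient of \<open>S\<close>.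
\<close>

text \<open>Any \<open>d > e\<close> exceeds some \<open>c\<close> in the set whose infimum is the
  Ky Fan distance, and since \<open>?P\<close> is antitone,
  \<open>?P d \<le> ?P c \<le> c < d\<close>. Letting \<open>d\<close> decrease to \<open>e\<close>
  carries the bound over to \<open>e\<close> itself, because the inequality in the event is
  strict.\<close>

lemma (in prob_space) ky_fan_le_imp_prob_le:
  assumes [measurable]: "X \<in> borel_measurable M" "Y \<in> borel_measurable M"
    and le: "ky_fan M X Y \<le> e"
  shows "prob {\<omega> \<in> space M. \<bar>X \<omega> - Y \<omega>\<bar> > e} \<le> e"
proof -
  let ?P = "\<lambda>d. prob {\<omega> \<in> space M. \<bar>X \<omega> - Y \<omega>\<bar> > d}"
  let ?K = "{d. 0 < d \<and> ?P d \<le> d}"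
  \<comment> \<open>Probabilities are at most 1, so \<open>?K\<close> is nonempty and its infimum
    can be approximated from within.\<close>
  have "1 \<in> ?K" by simp
  have antitone: "?P d \<le> ?P c" if "c \<le> d" for c d
    using that by (intro finite_measure_mono) auto
  have above: "?P d \<le> d" if "e < d" for d
  proof -
    have "Inf ?K < d" using le that by (simp add: ky_fan_def)
    then obtain c where "c \<in> ?K" "c < d"
      using cInf_lessD[of ?K d] \<open>1 \<in> ?K\<close> by blast
    then show ?thesis using antitone[of c d] by auto
  qed
  \<comment> \<open>The thresholds stay strictly above \<open>e\<close>, where the bound is known,
    and decrease to \<open>e\<close>.\<close>
  let ?A = "\<lambda>n. {\<omega> \<in> space M. \<bar>X \<omega> - Y \<omega>\<bar> > e + inverse (real (Suc n))}"
  have "incseq ?A"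
  proof (rule incseq_SucI)
    fix n
    have "e + inverse (real (Suc (Suc n))) \<le> e + inverse (real (Suc n))"
      by (intro add_left_mono le_imp_inverse_le) auto
    then show "?A n \<subseteq> ?A (Suc n)" by (blast intro: le_less_trans)
  qed
  moreover have "(\<Union>n. ?A n) = {\<omega> \<in> space M. \<bar>X \<omega> - Y \<omega>\<bar> > e}"
  proof -
    have "\<exists>n. e + inverse (real (Suc n)) < t" if "e < t" for t
      using reals_Archimedean[of "t - e"] that by (auto simp: algebra_simps)
    moreover have "e < t" if "e + inverse (real (Suc n)) < t" for t n
      using that by (smt (verit) inverse_nonnegative_iff_nonnegative of_nat_0_le_iff)
    ultimately show ?thesis by blast
  qed
  ultimately have "(\<lambda>n. prob (?A n)) \<longlonglongrightarrow> ?P e"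
    using finite_Lim_measure_incseq[of ?A] by (auto simp: image_subset_iff)
  moreover have "(\<lambda>n. e + inverse (real (Suc n))) \<longlonglongrightarrow> e + 0"
    by (intro tendsto_add tendsto_const LIMSEQ_inverse_real_of_nat)
  moreover have "prob (?A n) \<le> e + inverse (real (Suc n))" for n
    by (rule above) simp
  ultimately show ?thesis
    using LIMSEQ_le by fastforce
qed

text \<open>Finite and infinite arguments become one series with 0-1 weights. Monotonicity can then
  be read off termwise, and the mean can be taken term by term.\<close>

lemma S_fun_eq_suminf:
  "S_fun \<theta> n0 \<epsilon> N = (\<Sum>k. ennreal (S_coeff \<theta> \<epsilon> (n0 + k)) * of_bool (enat k < N))"
proof (cases N)
  case (enat p)
  have "(\<Sum>k. ennreal (S_coeff \<theta> \<epsilon> (n0 + k)) * of_bool (enat k < N)) =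
      (\<Sum>k<p. ennreal (S_coeff \<theta> \<epsilon> (n0 + k)) * of_bool (enat k < N))"
    by (rule suminf_finite) (auto simp: enat)
  also have "\<dots> = (\<Sum>n = n0..<n0 + p. ennreal (S_coeff \<theta> \<epsilon> n))"
    using sum.shift_bounds_nat_ivl[of "\<lambda>n. ennreal (S_coeff \<theta> \<epsilon> n)" 0 n0 p]
    by (simp add: enat add.commute lessThan_atLeast0)
  finally show ?thesis by (simp add: S_fun_def enat)
qed (simp add: S_fun_def)

lemma S_fun_mono: "N \<le> N' \<Longrightarrow> S_fun \<theta> n0 \<epsilon> N \<le> S_fun \<theta> n0 \<epsilon> N'"
  unfolding S_fun_eq_suminf by (intro suminf_le mult_left_mono summableI) auto

text \<open>Since \<open>n0 \<ge> 1\<close>, \<open>k < m + 1 - n0\<close> means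
  \<open>n0 + k - 1 < m\<close>. Lying strictly below a supremum means lying below some member,
  which covers the empty and the infinite set of exceedances as well.\<close>

lemma less_last_exceed_pos_iff:
  assumes "n0 \<ge> 1"
  shows "enat k < last_exceed_pos X Y \<epsilon> n0 \<omega> \<longleftrightarrow> (\<exists>n\<ge>n0 + k. \<bar>X n \<omega> - Y \<omega>\<bar> > \<epsilon> n)"
proof -
  have "enat k < last_exceed_pos X Y \<epsilon> n0 \<omega> \<longleftrightarrow> enat (n0 + k - 1) < last_exceed X Y \<epsilon> n0 \<omega>"
    using assms unfolding last_exceed_pos_def
    by (cases "last_exceed X Y \<epsilon> n0 \<omega>") (auto simp: one_enat_def)
  also have "\<dots> \<longleftrightarrow> (\<exists>n\<ge>n0 + k. \<bar>X n \<omega> - Y \<omega>\<bar> > \<epsilon> n)"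
  proof -
    have "n0 + k - 1 < n \<longleftrightarrow> n0 + k \<le> n" for n
      using assms by linarith
    then show ?thesis unfolding last_exceed_def less_SUP_iff by (auto intro: add_leD1)
  qed
  finally show ?thesis .
qed

lemma last_exceed_pos_le_last_exceed:
  assumes "n0 \<ge> 1"
  shows "last_exceed_pos X Y \<epsilon> n0 \<omega> \<le> last_exceed X Y \<epsilon> n0 \<omega>"
  using assms unfolding last_exceed_pos_def
  by (cases "last_exceed X Y \<epsilon> n0 \<omega>") (auto simp: one_enat_def)

text \<open>Every exceedance has an offset from \<open>n0\<close> below the number \<open>p\<close>
  of positions, so at most \<open>p\<close> indicators equal 1. An infinite right-hand side is
  trivial.\<close>

lemma overlap_le_last_exceed_pos:
  assumes "n0 \<ge> 1"
  shows "overlap X Y \<epsilon> n0 \<omega> \<le> last_exceed_pos X Y \<epsilon> n0 \<omega>"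
proof (cases "last_exceed_pos X Y \<epsilon> n0 \<omega>")
  case (enat p)
  let ?E = "{k. \<bar>X (n0 + k) \<omega> - Y \<omega>\<bar> > \<epsilon> (n0 + k)}"
  have "k < p" if "k \<in> ?E" for k
    using that less_last_exceed_pos_iff[OF assms, of k X Y \<epsilon> \<omega>] by (auto simp: enat)
  then have "?E \<subseteq> {..<p}" by blast
  have "overlap X Y \<epsilon> n0 \<omega> = (\<Sum>k<p. of_bool (k \<in> ?E))"
    using \<open>?E \<subseteq> {..<p}\<close> unfolding overlap_def
    by (subst suminf_finite[of "{..<p}"]) (auto simp: indicator_def)
  also have "\<dots> \<le> (\<Sum>k<p. 1)"
    by (rule sum_mono) (simp add: zero_le)
  also have "\<dots> = enat p" by (simp add: of_nat_eq_enat)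
  finally show ?thesis by (simp add: enat)
qed simp

theorem corollary6:
  fixes M :: "'a measure"
    and X :: "nat \<Rightarrow> 'a \<Rightarrow> real" and Y :: "'a \<Rightarrow> real"
    and \<epsilon> :: "nat \<Rightarrow> real" and n0 :: nat
  assumes "prob_space M"
    and "n0 \<ge> 1"
    and "\<And>n. n \<ge> n0 \<Longrightarrow> X n \<in> borel_measurable M"
    and "Y \<in> borel_measurable M"
    and "\<And>n. n \<ge> n0 \<Longrightarrow> \<epsilon> n > 0"
    and "\<And>m n. n0 \<le> m \<Longrightarrow> m \<le> n \<Longrightarrow> \<epsilon> n \<le> \<epsilon> m"
    and "summable (\<lambda>k. \<epsilon> (n0 + k))"
    and "\<And>n. n \<ge> n0 \<Longrightarrow> ky_fan M (X n) Y \<le> \<epsilon> n"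
  shows "(\<forall>e>0. summable (\<lambda>k. measure M {\<omega> \<in> space M. \<bar>X (n0 + k) \<omega> - Y \<omega>\<bar> > e}))
    \<and> (AE \<omega> in M. limsup (\<lambda>n. ereal (\<bar>X n \<omega> - Y \<omega>\<bar> * inverse (\<epsilon> n))) \<le> 1)
    \<and> (\<forall>\<theta>>0.
         (\<integral>\<^sup>+\<omega>. S_fun \<theta> n0 \<epsilon> (overlap X Y \<epsilon> n0 \<omega>) \<partial>M)
           \<le> (\<integral>\<^sup>+\<omega>. S_fun \<theta> n0 \<epsilon> (last_exceed X Y \<epsilon> n0 \<omega>) \<partial>M)
       \<and> (\<integral>\<^sup>+\<omega>. S_fun \<theta> n0 \<epsilon> (overlap X Y \<epsilon> n0 \<omega>) \<partial>M)
           \<le> (\<integral>\<^sup>+\<omega>. S_fun \<theta> n0 \<epsilon> (last_exceed_pos X Y \<epsilon> n0 \<omega>) \<partial>M)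
       \<and> (\<integral>\<^sup>+\<omega>. S_fun \<theta> n0 \<epsilon> (last_exceed_pos X Y \<epsilon> n0 \<omega>) \<partial>M)
           \<le> (\<Sum>k. ennreal (1 / (real (n0 + k) * ln (real (n0 + k + 1)) powr (1 + \<theta>)))))"
proof -
  interpret prob_space M by fact
  note [measurable] = assms(3,4)
  note n0 = assms(2) and pos = assms(5) and summ = assms(7)
  let ?A = "\<lambda>n. {\<omega> \<in> space M. \<bar>X n \<omega> - Y \<omega>\<bar> > \<epsilon> n}"
  have A_sets: "?A n \<in> sets M" if "n \<ge> n0" for n
    using assms(3)[OF that] by measurable
  have A_le: "prob (?A n) \<le> \<epsilon> n" if "n \<ge> n0" for n
    using assms(3)[OF that] assms(4) assms(8)[OF that] by (rule ky_fan_le_imp_prob_le)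

  have complete: "summable (\<lambda>k. prob {\<omega> \<in> space M. \<bar>X (n0 + k) \<omega> - Y \<omega>\<bar> > e})" if "e > 0" for e
  proof (rule summable_comparison_test_ev[OF _ summ])
    \<comment> \<open>Summability forces \<open>\<epsilon>\<close> to 0; once it is below
      \<open>e\<close>, exceeding \<open>e\<close> implies exceeding
      \<open>\<epsilon>\<close>.\<close>
    have "eventually (\<lambda>k. \<epsilon> (n0 + k) < e) sequentially"
      using summable_LIMSEQ_zero[OF summ] that by (rule order_tendstoD)
    then show "eventually (\<lambda>k. norm (prob {\<omega> \<in> space M. \<bar>X (n0 + k) \<omega> - Y \<omega>\<bar> > e}) \<le> \<epsilon> (n0 + k))
      sequentially"
    proof eventually_elim
      case (elim k)
      have "prob {\<omega> \<in> space M. \<bar>X (n0 + k) \<omega> - Y \<omega>\<bar> > e} \<le> prob (?A (n0 + k))"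
        using elim A_sets by (intro finite_measure_mono) auto
      then show ?case using A_le[of "n0 + k"] by simp
    qed
  qed

  have "summable (\<lambda>k. prob (?A (n0 + k)))"
    by (rule summable_comparison_test'[OF summ]) (simp add: A_le)
  then have "AE \<omega> in M. eventually (\<lambda>k. \<omega> \<in> space M - ?A (n0 + k)) sequentially"
    using A_sets by (intro borel_cantelli_AE1) (auto simp: emeasure_eq_measure)
  then have tolerance: "AE \<omega> in M. limsup (\<lambda>n. ereal (\<bar>X n \<omega> - Y \<omega>\<bar> * inverse (\<epsilon> n))) \<le> 1"
  proof eventually_elim
    case (elim \<omega>)
    then have "eventually (\<lambda>k. ereal (\<bar>X (k + n0) \<omega> - Y \<omega>\<bar> * inverse (\<epsilon> (k + n0))) \<le> 1) sequentially"
    proof eventually_elim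
      case (elim k)
      then show ?case using pos[of "n0 + k"]
        by (auto simp: add.commute divide_inverse[symmetric])
    qed
    \<comment> \<open>The bound holds eventually along the shifted sequence, and a shift by
      \<open>n0\<close> does not affect eventual statements.\<close>
    then have "eventually (\<lambda>n. ereal (\<bar>X n \<omega> - Y \<omega>\<bar> * inverse (\<epsilon> n)) \<le> 1) sequentially"
      using eventually_sequentially_seg[of _ n0] by (rule iffD1[rotated])
    then show ?case by (rule Limsup_bounded)
  qed

  have incidence: "(\<integral>\<^sup>+\<omega>. S_fun \<theta> n0 \<epsilon> (last_exceed_pos X Y \<epsilon> n0 \<omega>) \<partial>M)
      \<le> (\<Sum>k. ennreal (1 / (real (n0 + k) * ln (real (n0 + k + 1)) powr (1 + \<theta>))))" for \<theta>
  proof -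
    let ?c = "\<lambda>k. ennreal (S_coeff \<theta> \<epsilon> (n0 + k))"
    \<comment> \<open>The event that some exceedance has index at least \<open>n0 + k\<close>, that
      is, that term \<open>k\<close> of the series for \<open>S_fun\<close> is present.\<close>
    let ?B = "\<lambda>k. \<Union>j. ?A (n0 + k + j)"
    have B_sets: "?B k \<in> sets M" for k
      using A_sets by (intro sets.countable_UN) auto
    have "(\<integral>\<^sup>+\<omega>. S_fun \<theta> n0 \<epsilon> (last_exceed_pos X Y \<epsilon> n0 \<omega>) \<partial>M)
        = (\<integral>\<^sup>+\<omega>. (\<Sum>k. ?c k * indicator (?B k) \<omega>) \<partial>M)"
      unfolding S_fun_eq_suminf
    proof (intro nn_integral_cong suminf_cong arg_cong2[where f = "(*)"] refl)
      fix \<omega> k assume "\<omega> \<in> space M"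
      then show "of_bool (enat k < last_exceed_pos X Y \<epsilon> n0 \<omega>) = (indicator (?B k) \<omega> :: ennreal)"
        by (auto simp: less_last_exceed_pos_iff[OF n0] indicator_def le_iff_add)
    qed
    \<comment> \<open>All terms are nonnegative, so integral and series may be interchanged.\<close>
    also have "\<dots> = (\<Sum>k. ?c k * emeasure M (?B k))"
      using B_sets by (subst nn_integral_suminf) (auto simp: nn_integral_cmult_indicator)
    also have "\<dots> \<le> (\<Sum>k. ennreal (1 / (real (n0 + k) * ln (real (n0 + k + 1)) powr (1 + \<theta>))))"
    proof (intro suminf_le summableI)
      fix k
      let ?T = "\<Sum>j. \<epsilon> (n0 + k + j)"
      let ?w = "real (n0 + k) * ln (real (n0 + k + 1)) powr (1 + \<theta>)"
      have tail: "summable (\<lambda>j. \<epsilon> (n0 + k + j))"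
        using summable_ignore_initial_segment[OF summ, of k] by (simp add: ac_simps)
      \<comment> \<open>Strict positivity is what allows \<open>?T\<close> to cancel against its
        inverse inside \<open>S_coeff\<close>.\<close>
      have "?T > 0"
        by (rule suminf_pos[OF tail]) (simp add: pos)
      have "emeasure M (?B k) \<le> (\<Sum>j. emeasure M (?A (n0 + k + j)))"
        using A_sets by (intro emeasure_subadditive_countably) auto
      also have "\<dots> \<le> (\<Sum>j. ennreal (\<epsilon> (n0 + k + j)))"
        using A_le by (intro suminf_le summableI) (auto simp: emeasure_eq_measure intro!: ennreal_leI)
      also have "\<dots> = ennreal ?T"
        using tail pos by (intro suminf_ennreal2) (auto intro!: less_imp_le)
      finally have "?c k * emeasure M (?B k) \<le> ?c k * ennreal ?T"
        by (rule mult_left_mono) simp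
      also have "\<dots> = ennreal (S_coeff \<theta> \<epsilon> (n0 + k) * ?T)"
        using \<open>?T > 0\<close> by (simp add: ennreal_mult'')
      also have "S_coeff \<theta> \<epsilon> (n0 + k) * ?T = 1 / ?w"
        using \<open>?T > 0\<close> by (simp add: S_coeff_def inverse_eq_divide del: of_nat_add of_nat_Suc)
      finally show "?c k * emeasure M (?B k) \<le> ennreal (1 / ?w)" .
    qed
    finally show ?thesis .
  qed

  \<comment> \<open>Both comparisons with \<open>overlap\<close> hold pointwise by monotonicity of
    \<open>S_fun\<close>; the one with \<open>last_exceed\<close> passes through
    \<open>last_exceed_pos\<close>.\<close>
  show ?thesis
    using complete tolerance incidence n0
    by (auto intro!: nn_integral_mono S_fun_mono overlap_le_last_exceed_pos
        order_trans[OF overlap_le_last_exceed_pos last_exceed_pos_le_last_exceed])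
qed

end
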